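(* Let $k_1,k_2\ge1$ be integers. For all $n\ge\min(k_1,k_2)$, $$P_{q,\theta}(\widetilde W_S=n)=\widetilde P^{(1)}_{q,S}(n)+\widetilde P^{(0)}_{q,S}(n),$$ where $\widetilde P^{(1)}_{q,S}(k_1)=\theta^{k_1}$, $\widetilde P^{(0)}_{q,S}(k_2)=\prod_{j=1}^{k_2}(1-\theta q^{j-1})$, for $n>k_1$ $$\widetilde P^{(1)}_{q,S}(n)=\sum_{i=1}^{\min(n-k_1,k_2-1)}\theta^{n-i}q^{ik_1}\prod_{j=1}^{i}(1-\theta q^{j-1})\sum_{s=1}^{i}\Big[\overline E_{q,0,0}^{k_1,\infty}(n-k_1-i,i,s)+\overline F_{q,0,0}^{k_1,\infty}(n-k_1-i,i,s)\Big],$$ and for $n>k_2$ $$\widetilde P^{(0)}_{q,S}(n)=\theta^{n-k_2}\prod_{j=1}^{k_2}(1-\theta q^{j-1})\sum_{s=1}^{k_2}\Big[\overline E_{q,0,0}^{k_1,\infty}(n-k_2,k_2,s)+\overline F_{q,0,0}^{k_1,\infty}(n-k_2,k_2,s)\Big].$$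
   Context: Model: fix reals $0\le\theta\le1$ and $0<q<1$. $(X_j)_{j\ge1}$ is a sequence of $\{0,1\}$-valued random variables (1 = success, 0 = failure) with law $P_{q,\theta}$ such that, conditionally on $X_1,\dots,X_{j-1}$ containing exactly $i-1$ zeros, $X_j=0$ with probability $1-\theta q^{i-1}$ and $X_j=1$ with probability $\theta q^{i-1}$. Conventions: $0^0=1$, empty products are 1, empty sums are 0. Waiting times: $T_1$ is the least $n\ge k_1$ with $X_{n-k_1+1}=\dots=X_n=1$; $N_0$ is the trial at which the $k_2$-th failure (in total) occurs ($\infty$ if it does not occur). $\widetilde W_S=\min(T_1,N_0)$ (run quota on successes, frequency quota on failures, sooner case); $\widetilde P^{(1)}_{q,S}(n)=P_{q,\theta}(T_1=n,\ N_0>n)$ and $\widetilde P^{(0)}_{q,S}(n)=P_{q,\theta}(N_0=n,\ T_1>n)$. Combinatorial sums, for integers $u,v$ and $s\ge1$, all variables being positive integers (a family of zero variables consists of the single empty tuple, with sum $0$): - $\overline E_{q,0,0}^{k_1,\infty}(u,v,s)=\sum q^{\sum_{j=1}^{s-1}(y_1+\dots+y_j)x_j}$ over $(x_1,\dots,x_{s-1})$ with $\sum x_j=u$, all $x_j<k_1$, and $(y_1,\dots,y_s)$ with $\sum y_j=v$; - $\overline F_{q,0,0}^{k_1,\infty}(u,v,s)=\sum q^{\sum_{j=2}^{s}(y_1+\dots+y_{j-1})x_j}$ over $(x_1,\dots,x_s)$ with $\sum x_j=u$, all $x_j<k_1$, and $(y_1,\dots,y_s)$ with $\sum y_j=v$.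 *)

theory Defs
  imports "HOL-Probability.Probability" "HOL-Library.Extended_Nat"
begin

text \<open>
  Binary trials with values 0 (failure) and 1 (success), indexed from 1; \<open>X 0\<close> plays no role.
  The conditioning is on the whole history \<open>X 1 = e 1, \<dots>, X (j - 1) = e (j - 1)\<close>, for every history
  \<open>e\<close> with exactly \<open>i - 1\<close> zeros, so that the two conditions determine the joint law of the sequence.
  Only histories of positive probability are constrained, because \<open>cond_prob\<close> is 0 by convention
  on null events.
\<close>

locale q_bernoulli_trials = prob_space M
  for M :: "'a measure" and X :: "nat \<Rightarrow> 'a \<Rightarrow> nat" and q \<theta> :: real +
  assumes binary: "\<And>j. j \<ge> 1 \<Longrightarrow> random_variable (count_space {0, 1}) (X j)"
    and failure_prob:
      "\<And>i j e. \<lbrakk>i \<ge> 1; j \<ge> 1; card {l \<in> {1..<j}. e l = 0} = i - 1;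
         \<P>(\<omega> in M. \<forall>l\<in>{1..<j}. X l \<omega> = e l) > 0\<rbrakk>
       \<Longrightarrow> \<P>(\<omega> in M. X j \<omega> = 0 \<bar> \<forall>l\<in>{1..<j}. X l \<omega> = e l) = 1 - \<theta> * q ^ (i - 1)"
    and success_prob:
      "\<And>i j e. \<lbrakk>i \<ge> 1; j \<ge> 1; card {l \<in> {1..<j}. e l = 0} = i - 1;
         \<P>(\<omega> in M. \<forall>l\<in>{1..<j}. X l \<omega> = e l) > 0\<rbrakk>
       \<Longrightarrow> \<P>(\<omega> in M. X j \<omega> = 1 \<bar> \<forall>l\<in>{1..<j}. X l \<omega> = e l) = \<theta> * q ^ (i - 1)"

text \<open>Waiting times of an outcome sequence; the infimum of the empty set in \<open>enat\<close> is \<open>\<infinity>\<close>.\<close>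

definition success_run_time :: "nat \<Rightarrow> (nat \<Rightarrow> nat) \<Rightarrow> enat" where
  "success_run_time k x = (INF n \<in> {n. n \<ge> k \<and> (\<forall>j\<in>{n - k + 1..n}. x j = 1)}. enat n)"

definition failure_time :: "nat \<Rightarrow> (nat \<Rightarrow> nat) \<Rightarrow> enat" where
  "failure_time k x =
     (INF n \<in> {n. n \<ge> 1 \<and> x n = 0 \<and> card {j \<in> {1..n}. x j = 0} = k}. enat n)"

definition W_S :: "nat \<Rightarrow> nat \<Rightarrow> (nat \<Rightarrow> nat) \<Rightarrow> enat" where
  "W_S k1 k2 x = min (success_run_time k1 x) (failure_time k2 x)"

definition P1_S :: "'a measure \<Rightarrow> (nat \<Rightarrow> 'a \<Rightarrow> nat) \<Rightarrow> nat \<Rightarrow> nat \<Rightarrow> nat \<Rightarrow> real" where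
  "P1_S M X k1 k2 n =
     \<P>(\<omega> in M. success_run_time k1 (\<lambda>j. X j \<omega>) = enat n \<and> failure_time k2 (\<lambda>j. X j \<omega>) > enat n)"

definition P0_S :: "'a measure \<Rightarrow> (nat \<Rightarrow> 'a \<Rightarrow> nat) \<Rightarrow> nat \<Rightarrow> nat \<Rightarrow> nat \<Rightarrow> real" where
  "P0_S M X k1 k2 n =
     \<P>(\<omega> in M. failure_time k2 (\<lambda>j. X j \<omega>) = enat n \<and> success_run_time k1 (\<lambda>j. X j \<omega>) > enat n)"

text \<open>
  Tuples are extensional functions on their index set, so the family of zero variables consists of
  exactly one (empty) tuple. The index sets of both sums are finite, as the \<open>y j\<close> are positive
  with sum \<open>v\<close>; see the lemmas below.
\<close>

definition E_tuples :: "nat \<Rightarrow> int \<Rightarrow> int \<Rightarrow> nat \<Rightarrow> ((nat \<Rightarrow> nat) \<times> (nat \<Rightarrow> nat)) set" where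
  "E_tuples k u v s =
     {(x, y). x \<in> {1..s - 1} \<rightarrow>\<^sub>E {1..<k} \<and> (\<Sum>j = 1..s - 1. int (x j)) = u \<and>
              y \<in> {1..s} \<rightarrow>\<^sub>E {1..} \<and> (\<Sum>j = 1..s. int (y j)) = v}"

definition E_bar :: "real \<Rightarrow> nat \<Rightarrow> int \<Rightarrow> int \<Rightarrow> nat \<Rightarrow> real" where
  "E_bar q k u v s =
     (\<Sum>(x, y) \<in> E_tuples k u v s. q ^ (\<Sum>j = 1..s - 1. (\<Sum>i = 1..j. y i) * x j))"

definition F_tuples :: "nat \<Rightarrow> int \<Rightarrow> int \<Rightarrow> nat \<Rightarrow> ((nat \<Rightarrow> nat) \<times> (nat \<Rightarrow> nat)) set" where
  "F_tuples k u v s =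
     {(x, y). x \<in> {1..s} \<rightarrow>\<^sub>E {1..<k} \<and> (\<Sum>j = 1..s. int (x j)) = u \<and>
              y \<in> {1..s} \<rightarrow>\<^sub>E {1..} \<and> (\<Sum>j = 1..s. int (y j)) = v}"

definition F_bar :: "real \<Rightarrow> nat \<Rightarrow> int \<Rightarrow> int \<Rightarrow> nat \<Rightarrow> real" where
  "F_bar q k u v s =
     (\<Sum>(x, y) \<in> F_tuples k u v s. q ^ (\<Sum>j = 2..s. (\<Sum>i = 1..j - 1. y i) * x j))"

lemma finite_compositions:
  fixes s :: nat
  shows "finite {y. y \<in> {1..s} \<rightarrow>\<^sub>E {1::nat..} \<and> (\<Sum>j = 1..s. int (y j)) = v}"
proof (rule finite_subset)
  show "{y. y \<in> {1..s} \<rightarrow>\<^sub>E {1::nat..} \<and> (\<Sum>j = 1..s. int (y j)) = v} \<subseteq> {1..s} \<rightarrow>\<^sub>E {..nat v}"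
  proof clarify
    fix y assume y: "y \<in> {1..s} \<rightarrow>\<^sub>E {1::nat..}" and v: "v = (\<Sum>j = 1..s. int (y j))"
    have "int (y j) \<le> (\<Sum>j = 1..s. int (y j))" if "j \<in> {1..s}" for j
      by (rule member_le_sum[where f = "\<lambda>j. int (y j)"]) (use that in auto)
    then have "y j \<le> nat (\<Sum>j = 1..s. int (y j))" if "j \<in> {1..s}" for j
      using that by (metis nat_int nat_mono)
    with y show "y \<in> {1..s} \<rightarrow>\<^sub>E {..nat (\<Sum>j = 1..s. int (y j))}"
      by (auto simp: PiE_iff)
  qed
qed (simp add: finite_PiE)

lemma finite_E_tuples: "finite (E_tuples k u v s)"
  by (rule finite_subset[OF _ finite_cartesian_product[OF
        finite_PiE[of "{1..s - 1}" "\<lambda>_. {1..<k}"] finite_compositions[of s v]]])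
     (auto simp: E_tuples_def)

lemma finite_F_tuples: "finite (F_tuples k u v s)"
  by (rule finite_subset[OF _ finite_cartesian_product[OF
        finite_PiE[of "{1..s}" "\<lambda>_. {1..<k}"] finite_compositions[of s v]]])
     (auto simp: F_tuples_def)

end

theory Submission
  imports Defs
begin

text \<open>
  Record the first \<open>n\<close> trials as a word of booleans, \<open>True\<close> for a success. The product rule for
  conditional probabilities gives each word its probability: a success that comes after \<open>i\<close> failures
  contributes \<open>\<theta> q\<^sup>i\<close>, and the \<open>j\<close>-th failure contributes \<open>1 - \<theta> q\<^bsup>j - 1\<^esup>\<close>. So among words with \<open>u\<close>
  successes and \<open>v\<close> failures only the power of \<open>q\<close> varies: every success is weighted by the number of
  failures before it.

  Both waiting time events are sets of words. The \<open>k2\<close>-th failure comes first, at trial \<open>n\<close>, iff the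
  word ends in a failure, has \<open>k2\<close> failures and no \<open>k1\<close> consecutive successes. The success run comes
  first iff the word is a word with these properties (but with some \<open>i < k2\<close> failures; possibly empty)
  followed by exactly \<open>k1\<close> successes, which adds the factor \<open>(\<theta> q\<^sup>i)\<^bsup>k1\<^esup>\<close>. The words that remain to be
  summed over consist of \<open>v\<close> blocks, each a failure preceded by fewer than \<open>k1\<close> successes. Such a word
  is determined by its block lengths, and removing the last block gives a recursion
  (\<open>sum_word_prob_blocks\<close>) whose solution, up to the common factor, is the polynomial \<open>gap_sum\<close>.

  The sums \<open>E_bar\<close> and \<open>F_bar\<close> count the same words by their maximal runs instead: the \<open>x j\<close> are the
  lengths of the success runs, the \<open>y j\<close> those of the \<open>s\<close> failure runs, and \<open>E_bar\<close> collects the words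
  that start with a failure, \<open>F_bar\<close> those that start with a success. Removing the last run of either
  kind shows that the sum over \<open>s\<close> satisfies the recursion of \<open>gap_sum\<close> (\<open>sum_runs_sum_eq_gap_sum\<close>).
  Comparing the two recursions avoids an explicit bijection between tuples and words.
\<close>

section \<open>Run lengths and the tuple sums\<close>

text \<open>
  The generating polynomial of the gap vectors: the sum of \<open>q\<^bsup>0 g\<^sub>0 + 1 g\<^sub>1 + \<dots> + (v - 1) g\<^bsub>v - 1\<^esub>\<^esup>\<close> over all
  \<open>g\<^sub>0, \<dots>, g\<^bsub>v - 1\<^esub> < k\<close> with sum \<open>u\<close>, where \<open>g\<^sub>l\<close> is the number of successes between the \<open>l\<close>-th and the
  next failure (\<open>g\<^sub>0\<close>: before the first). The argument \<open>u\<close> is an integer so that \<open>u - int x\<close> needs no side condition.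
\<close>

primrec gap_sum :: "real \<Rightarrow> nat \<Rightarrow> int \<Rightarrow> nat \<Rightarrow> real" where
  "gap_sum q k u 0 = of_bool (u = 0)"
| "gap_sum q k u (Suc v) = (\<Sum>x<k. q ^ (v * x) * gap_sum q k (u - int x) v)"

lemma gap_sum_negative: "u < 0 \<Longrightarrow> gap_sum q k u v = 0"
  by (induction v arbitrary: u) auto

lemma gap_sum_one: "gap_sum q k u (Suc 0) = of_bool (0 \<le> u \<and> u < int k)"
proof (cases "0 \<le> u")
  case True
  have "gap_sum q k u (Suc 0) = (\<Sum>x<k. if x = nat u then 1 else 0)"
    unfolding gap_sum.simps by (intro sum.cong) (use True in auto)
  then show ?thesis using True by (auto simp: nat_less_iff)
qed (simp add: gap_sum_negative del: gap_sum.simps)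

text \<open>
  The index sets of \<open>F_bar\<close> (\<open>d = 0\<close>) and \<open>E_bar\<close> (\<open>d = 1\<close>) in one family: there are \<open>r\<close> success runs and
  \<open>r + d\<close> failure runs, and \<open>d\<close> of the latter come before the first success run. Hence \<open>j + d - 1\<close>
  failure runs precede the \<open>j\<close>-th success run.
\<close>

definition tuple_family :: "nat \<Rightarrow> nat \<Rightarrow> nat \<Rightarrow> int \<Rightarrow> nat \<Rightarrow> ((nat \<Rightarrow> nat) \<times> (nat \<Rightarrow> nat)) set" where
  "tuple_family k d r u v =
     {(x, y). x \<in> {1..r} \<rightarrow>\<^sub>E {1..<k} \<and> (\<Sum>j = 1..r. int (x j)) = u \<and>
              y \<in> {1..r + d} \<rightarrow>\<^sub>E {1..} \<and> (\<Sum>j = 1..r + d. y j) = v}"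

definition tuple_sum :: "real \<Rightarrow> nat \<Rightarrow> nat \<Rightarrow> nat \<Rightarrow> int \<Rightarrow> nat \<Rightarrow> real" where
  "tuple_sum q k d r u v =
     (\<Sum>(x, y) \<in> tuple_family k d r u v. q ^ (\<Sum>j = 1..r. (\<Sum>i = 1..j + d - 1. y i) * x j))"

lemma E_bar_eq_tuple_sum:
  assumes "s \<ge> 1"
  shows "E_bar q k u (int v) s = tuple_sum q k 1 (s - 1) u v"
proof -
  have "E_tuples k u (int v) s = tuple_family k 1 (s - 1) u v"
    using assms unfolding E_tuples_def tuple_family_def
    by (simp flip: of_nat_sum)
  then show ?thesis by (simp add: E_bar_def tuple_sum_def)
qed

lemma F_bar_eq_tuple_sum:
  assumes "s \<ge> 1"
  shows "F_bar q k u (int v) s = tuple_sum q k 0 s u v"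
proof -
  have "F_tuples k u (int v) s = tuple_family k 0 s u v"
    unfolding F_tuples_def tuple_family_def by (simp flip: of_nat_sum)
  moreover have "(\<Sum>j = 1..s. (\<Sum>i = 1..j - 1. y i) * x j) = (\<Sum>j = 2..s. (\<Sum>i = 1..j - 1. y i) * x j)"
    for x y :: "nat \<Rightarrow> nat"
    using assms by (simp add: sum.atLeast_Suc_atMost numeral_2_eq_2)
  ultimately show ?thesis by (simp add: F_bar_def tuple_sum_def)
qed

lemma finite_tuple_family: "finite (tuple_family k d r u v)"
proof (rule finite_subset)
  show "tuple_family k d r u v \<subseteq>
      ({1..r} \<rightarrow>\<^sub>E {1..<k}) \<times> {y. y \<in> {1..r + d} \<rightarrow>\<^sub>E {1..} \<and> (\<Sum>j = 1..r + d. int (y j)) = int v}"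
    by (auto simp: tuple_family_def simp flip: of_nat_sum)
  show "finite (({1..r} \<rightarrow>\<^sub>E {1..<k}) \<times> {y. y \<in> {1..r + d} \<rightarrow>\<^sub>E {1..} \<and> (\<Sum>j = 1..r + d. int (y j)) = int v})"
    using finite_compositions by (intro finite_cartesian_product finite_PiE) auto
qed

text \<open>
  The \<open>r + d\<close> failure runs are nonempty, so they need at least \<open>r + d\<close> failures.
\<close>

lemma tuple_sum_eq_0:
  assumes "v < r + d"
  shows "tuple_sum q k d r u v = 0"
proof -
  have "tuple_family k d r u v = {}"
  proof (intro equals0I, clarify)
    fix x y assume *: "(x, y) \<in> tuple_family k d r u v"
    have "(\<Sum>j = 1..r + d. 1) \<le> (\<Sum>j = 1..r + d. y j)"
      using * by (intro sum_mono) (fastforce simp: tuple_family_def PiE_iff)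
    then show False using * assms by (auto simp: tuple_family_def)
  qed
  then show ?thesis by (simp add: tuple_sum_def)
qed

lemma sum_nested:
  assumes "finite A" and "finite B" and "\<And>l a. finite (C l a)"
  shows "(\<Sum>(l, a, p) \<in> (SIGMA l : A. SIGMA a : B. C l a). g l a p) =
           (\<Sum>l\<in>A. \<Sum>a\<in>B. \<Sum>p\<in>C l a. g l a p)"
proof -
  have "(\<Sum>l\<in>A. \<Sum>a\<in>B. \<Sum>p\<in>C l a. g l a p) = (\<Sum>l\<in>A. \<Sum>(a, p) \<in> Sigma B (C l). g l a p)"
    using assms by (intro sum.cong refl sum.Sigma) auto
  also have "\<dots> = (\<Sum>(l, ap) \<in> (SIGMA l : A. Sigma B (C l)). case ap of (a, p) \<Rightarrow> g l a p)"
    using assms by (intro sum.Sigma) auto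
  finally show ?thesis by simp
qed

text \<open>
  Remove the last success run and the failure run after it. If \<open>a\<close> is the length of the former and \<open>l\<close>
  the number of failures before it, then its contribution is \<open>q\<^bsup>l a\<^esup>\<close>, and the last failure run has
  the length \<open>v - l\<close>. The assumption makes sure that there is a failure run left, so that \<open>l \<ge> 1\<close>.
\<close>

lemma tuple_sum_rec:
  assumes "r + d \<ge> 1"
  shows "tuple_sum q k d (Suc r) u v =
           (\<Sum>l = 1..<v. \<Sum>a = 1..<k. q ^ (l * a) * tuple_sum q k d r (u - int a) l)"
proof -
  let ?S = "SIGMA l : {1..<v}. SIGMA a : {1..<k}. tuple_family k d r (u - int a) l"
  let ?f = "\<lambda>r (x, y). q ^ (\<Sum>j = 1..r. (\<Sum>i = 1..j + d - 1. y i) * x j) :: real"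
  let ?split = "\<lambda>(x, y). (\<Sum>i = 1..r + d. y i, x (Suc r), x(Suc r := undefined), y(Suc (r + d) := undefined))"
  let ?join = "\<lambda>(l, a, x, y). (x(Suc r := a), y(Suc (r + d) := v - l))"
  have upd: "(\<Sum>i = Suc 0..m. (f(Suc n := c)) i) = (\<Sum>i = Suc 0..m. f i)" if "m \<le> n"
    for f :: "nat \<Rightarrow> nat" and m n c
    by (rule sum.cong) (use that in auto)
  have updi: "(\<Sum>i = Suc 0..m. int ((f(Suc n := c)) i)) = (\<Sum>i = Suc 0..m. int (f i))" if "m \<le> n"
    for f :: "nat \<Rightarrow> nat" and m n c
    by (rule sum.cong) (use that in auto)
  have "tuple_sum q k d (Suc r) u v = (\<Sum>p \<in> tuple_family k d (Suc r) u v. ?f (Suc r) p)"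
    by (simp add: tuple_sum_def)
  also have "\<dots> = (\<Sum>(l, a, p) \<in> ?S. q ^ (l * a) * ?f r p)"
  proof (rule sum.reindex_bij_witness[where i = ?join and j = ?split])
    fix p assume "p \<in> tuple_family k d (Suc r) u v"
    then obtain x y where p: "p = (x, y)"
      and x: "x \<in> {1..Suc r} \<rightarrow>\<^sub>E {1..<k}" "(\<Sum>j = 1..Suc r. int (x j)) = u"
      and y: "y \<in> {1..Suc (r + d)} \<rightarrow>\<^sub>E {1..}" "(\<Sum>j = 1..Suc (r + d). y j) = v"
      by (cases p) (auto simp: tuple_family_def)
    have y_pos: "y i \<ge> 1" if "i \<in> {1..Suc (r + d)}" for i
      using y(1) that by (auto simp: PiE_iff)
    have l_pos: "(\<Sum>i = 1..r + d. y i) \<ge> 1"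
      using member_le_sum[of 1 "{1..r + d}" y] y_pos[of 1] assms by auto
    have v: "v = (\<Sum>i = 1..r + d. y i) + y (Suc (r + d))"
      using y(2) by simp
    show "?join (?split p) = p"
      using v by (auto simp: p)
    have "x(Suc r := undefined) \<in> {1..r} \<rightarrow>\<^sub>E {1..<k}"
      using x(1) by (auto simp: PiE_iff extensional_def)
    moreover have "y(Suc (r + d) := undefined) \<in> {1..r + d} \<rightarrow>\<^sub>E {1..}"
      using y(1) by (auto simp: PiE_iff extensional_def)
    moreover have "x (Suc r) \<in> {1..<k}"
      using x(1) by (auto simp: PiE_iff)
    moreover have "(\<Sum>i = 1..r + d. y i) \<in> {1..<v}"
      using l_pos v y_pos[of "Suc (r + d)"] by auto
    ultimately show "?split p \<in> ?S"
      using x(2) by (auto simp: p tuple_family_def upd updi simp del: fun_upd_apply)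
    have "(\<Sum>j = 1..r. (\<Sum>i = 1..j + d - 1. (y(Suc (r + d) := undefined)) i) * (x(Suc r := undefined)) j)
        = (\<Sum>j = 1..r. (\<Sum>i = 1..j + d - 1. y i) * x j)"
    proof (intro sum.cong refl)
      fix j assume j: "j \<in> {1..r}"
      then have "(\<Sum>i = 1..j + d - 1. (y(Suc (r + d) := undefined)) i) = (\<Sum>i = 1..j + d - 1. y i)"
        unfolding One_nat_def by (intro upd) auto
      with j show "(\<Sum>i = 1..j + d - 1. (y(Suc (r + d) := undefined)) i) * (x(Suc r := undefined)) j
          = (\<Sum>i = 1..j + d - 1. y i) * x j"
        by simp
    qed
    then show "(case ?split p of (l, a, p) \<Rightarrow> q ^ (l * a) * ?f r p) = ?f (Suc r) p"
      by (simp add: p power_add del: fun_upd_apply)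
  next
    fix t assume "t \<in> ?S"
    then obtain l a x y where t: "t = (l, a, x, y)" and l: "1 \<le> l" "l < v" and a: "1 \<le> a" "a < k"
      and x: "x \<in> {1..r} \<rightarrow>\<^sub>E {1..<k}" "(\<Sum>j = 1..r. int (x j)) = u - int a"
      and y: "y \<in> {1..r + d} \<rightarrow>\<^sub>E {1..}" "(\<Sum>j = 1..r + d. y j) = l"
      by (cases t) (auto simp: tuple_family_def)
    have "x (Suc r) = undefined" "y (Suc (r + d)) = undefined"
      using x(1) y(1) by (auto simp: PiE_iff extensional_def)
    then have "x(Suc r := undefined) = x" "y(Suc (r + d) := undefined) = y"
      by auto
    then show "?split (?join t) = t"
      using y(2) by (simp add: t upd del: fun_upd_apply) (simp)
    have "x(Suc r := a) \<in> {1..Suc r} \<rightarrow>\<^sub>E {1..<k}"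
      using x(1) a by (auto simp: PiE_iff extensional_def le_Suc_eq)
    moreover have "y(Suc (r + d) := v - l) \<in> {1..Suc (r + d)} \<rightarrow>\<^sub>E {1..}"
      using y(1) l by (auto simp: PiE_iff extensional_def le_Suc_eq)
    ultimately show "?join t \<in> tuple_family k d (Suc r) u v"
      using x(2) y(2) l by (auto simp: t tuple_family_def upd updi simp del: fun_upd_apply) (simp_all)
  qed
  also have "\<dots> = (\<Sum>l = 1..<v. \<Sum>a = 1..<k. \<Sum>p\<in>tuple_family k d r (u - int a) l. q ^ (l * a) * ?f r p)"
    by (rule sum_nested) (simp_all add: finite_tuple_family)
  also have "\<dots> = (\<Sum>l = 1..<v. \<Sum>a = 1..<k. q ^ (l * a) * tuple_sum q k d r (u - int a) l)"
    by (simp add: tuple_sum_def sum_distrib_left)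
  finally show ?thesis .
qed

text \<open>
  The words with exactly \<open>s\<close> failure runs, regardless of the outcome of the first trial.
\<close>

definition runs_sum :: "real \<Rightarrow> nat \<Rightarrow> nat \<Rightarrow> int \<Rightarrow> nat \<Rightarrow> real" where
  "runs_sum q k s u v = E_bar q k u (int v) s + F_bar q k u (int v) s"

lemma runs_sum_eq_tuple_sum:
  "s \<ge> 1 \<Longrightarrow> runs_sum q k s u v = tuple_sum q k 1 (s - 1) u v + tuple_sum q k 0 s u v"
  by (simp add: runs_sum_def E_bar_eq_tuple_sum F_bar_eq_tuple_sum)

text \<open>
  The recursions for \<open>Suc v\<close> and for \<open>v\<close> differ only by the summand \<open>l = v\<close>. In terms of words: either the
  last failure run can be shortened by one, or it is a single failure that is removed together with the
  success run before it.
\<close>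

lemma runs_sum_Suc:
  assumes "s \<ge> 1" and "v \<ge> 1"
  shows "runs_sum q k (Suc s) u (Suc v) =
           runs_sum q k (Suc s) u v + (\<Sum>a = 1..<k. q ^ (v * a) * runs_sum q k s (u - int a) v)"
proof -
  obtain r where r: "s = Suc r" using assms(1) by (cases s) auto
  show ?thesis
    using assms unfolding r
    by (simp add: runs_sum_eq_tuple_sum tuple_sum_rec[of r "Suc 0"] tuple_sum_rec[of "Suc r" 0]
        distrib_left sum.distrib)
qed

lemma runs_sum_eq_0: "s \<ge> 1 \<Longrightarrow> v < s \<Longrightarrow> runs_sum q k s u v = 0"
  by (simp add: runs_sum_eq_tuple_sum tuple_sum_eq_0)

text \<open>
  With one failure run the word is a single, possibly empty, success run followed by failures; the
  empty one comes from \<open>E_bar\<close>.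
\<close>

lemma runs_sum_1:
  assumes "k \<ge> 1" and "v \<ge> 1"
  shows "runs_sum q k 1 u v = of_bool (0 \<le> u \<and> u < int k)"
proof -
  define c where "c a = (\<lambda>j. if j = Suc 0 then a else undefined)" for a :: nat
  have single: "{x \<in> {Suc 0} \<rightarrow>\<^sub>E A. x (Suc 0) = a} = (if a \<in> A then {c a} else {})" for A a
    by (auto simp: c_def PiE_iff extensional_def)
  have single_int: "{x \<in> {Suc 0} \<rightarrow>\<^sub>E A. int (x (Suc 0)) = u} =
      (if 0 \<le> u then {x \<in> {Suc 0} \<rightarrow>\<^sub>E A. x (Suc 0) = nat u} else {})" for A
  proof -
    have "int (x (Suc 0)) = u \<longleftrightarrow> 0 \<le> u \<and> x (Suc 0) = nat u" for x :: "nat \<Rightarrow> nat"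
      by linarith
    then show ?thesis by (cases "0 \<le> u") simp_all
  qed
  have "tuple_family k 1 0 u v =
      {x. x = (\<lambda>_. undefined) \<and> u = 0} \<times> {y \<in> {Suc 0} \<rightarrow>\<^sub>E {Suc 0..}. y (Suc 0) = v}"
    by (auto simp: tuple_family_def)
  also have "\<dots> = (if u = 0 then {(\<lambda>_. undefined, c v)} else {})"
    using assms(2) by (auto simp: single)
  finally have E: "tuple_family k 1 0 u v = (if u = 0 then {(\<lambda>_. undefined, c v)} else {})" .
  have "tuple_family k 0 1 u v =
      {x \<in> {Suc 0} \<rightarrow>\<^sub>E {Suc 0..<k}. int (x (Suc 0)) = u} \<times>
      {y \<in> {Suc 0} \<rightarrow>\<^sub>E {Suc 0..}. y (Suc 0) = v}"
    by (auto simp: tuple_family_def)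
  also have "\<dots> = (if 1 \<le> u \<and> u < int k then {(c (nat u), c v)} else {})"
    using assms(2) unfolding single_int single by auto
  finally have F: "tuple_family k 0 1 u v = (if 1 \<le> u \<and> u < int k then {(c (nat u), c v)} else {})" .
  show ?thesis
    using assms(1) E F by (auto simp: runs_sum_eq_tuple_sum tuple_sum_def)
qed

text \<open>
  Summing \<open>runs_sum_Suc\<close> over \<open>s\<close> yields the recursion of \<open>gap_sum\<close>: the first summand is the term \<open>x = 0\<close>
  there, because \<open>v\<close> failures do not form \<open>v + 1\<close> runs. The induction starts at \<open>v = 1\<close>, since the
  tuple sums vanish for \<open>u = v = 0\<close> whereas \<open>gap_sum\<close> counts the empty word.
\<close>

lemma sum_runs_sum_eq_gap_sum:
  assumes "k \<ge> 1" and "v \<ge> 1"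
  shows "(\<Sum>s = 1..v. runs_sum q k s u v) = gap_sum q k u v"
  using assms(2)
proof (induction v arbitrary: u rule: nat_induct_at_least)
  case base
  then show ?case using assms(1) by (simp add: runs_sum_1[simplified] gap_sum_one del: gap_sum.simps)
next
  case (Suc v)
  have shift: "(\<Sum>s = 1..Suc m. f s) = f 1 + (\<Sum>s = 1..m. f (Suc s))" for f :: "nat \<Rightarrow> real" and m
    by (induction m) simp_all
  have "(\<Sum>s = 1..Suc v. runs_sum q k s u (Suc v))
      = runs_sum q k 1 u (Suc v) + (\<Sum>s = 1..v. runs_sum q k (Suc s) u (Suc v))"
    by (rule shift)
  also have "(\<Sum>s = 1..v. runs_sum q k (Suc s) u (Suc v)) =
      (\<Sum>s = 1..v. runs_sum q k (Suc s) u v)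
      + (\<Sum>s = 1..v. \<Sum>a = 1..<k. q ^ (v * a) * runs_sum q k s (u - int a) v)"
    using Suc.hyps by (simp add: runs_sum_Suc sum.distrib)
  also have "(\<Sum>s = 1..v. \<Sum>a = 1..<k. q ^ (v * a) * runs_sum q k s (u - int a) v)
      = (\<Sum>a = 1..<k. q ^ (v * a) * gap_sum q k (u - int a) v)"
    by (subst sum.swap) (simp add: Suc.IH[simplified] flip: sum_distrib_left)
  also have "runs_sum q k 1 u (Suc v) = runs_sum q k 1 u v"
    using assms(1) Suc.hyps by (simp add: runs_sum_1[simplified])
  also have "runs_sum q k 1 u v + ((\<Sum>s = 1..v. runs_sum q k (Suc s) u v)
        + (\<Sum>a = 1..<k. q ^ (v * a) * gap_sum q k (u - int a) v))
      = (\<Sum>s = 1..Suc v. runs_sum q k s u v) + (\<Sum>a = 1..<k. q ^ (v * a) * gap_sum q k (u - int a) v)"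
    unfolding shift by simp
  also have "(\<Sum>s = 1..Suc v. runs_sum q k s u v) = gap_sum q k u v"
    by (simp add: Suc.IH[simplified] runs_sum_eq_0)
  also have "gap_sum q k u v + (\<Sum>a = 1..<k. q ^ (v * a) * gap_sum q k (u - int a) v)
      = gap_sum q k u (Suc v)"
    using assms(1) by (simp add: lessThan_atLeast0 sum.atLeast_Suc_lessThan)
  finally show ?case .
qed

section \<open>Words without long success runs\<close>

text \<open>
  Absence of \<open>k\<close> consecutive successes, stated by the possible end points \<open>n\<close> of a run to match the definition of the success waiting time.
\<close>

definition run_free :: "nat \<Rightarrow> bool list \<Rightarrow> bool" where
  "run_free k w \<longleftrightarrow> (\<forall>n. k \<le> n \<and> n \<le> length w \<longrightarrow> (\<exists>i\<in>{n - k..<n}. \<not> w ! i))"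

lemma run_free_snoc:
  "run_free k (w @ [b]) \<longleftrightarrow>
     run_free k w \<and> (k \<le> Suc (length w) \<longrightarrow> (\<exists>i\<in>{Suc (length w) - k..length w}. \<not> (w @ [b]) ! i))"
proof -
  have "(\<exists>i\<in>{n - k..<n}. \<not> (w @ [b]) ! i) \<longleftrightarrow> (\<exists>i\<in>{n - k..<n}. \<not> w ! i)" if "n \<le> length w" for n
    using that by (intro bex_cong) (auto simp: nth_append)
  moreover have "(\<forall>n. k \<le> n \<and> n \<le> Suc m \<longrightarrow> Q n) \<longleftrightarrow>
      (\<forall>n. k \<le> n \<and> n \<le> m \<longrightarrow> Q n) \<and> (k \<le> Suc m \<longrightarrow> Q (Suc m))" for Q m
    by (auto simp: le_Suc_eq)
  ultimately show ?thesis
    unfolding run_free_def by (simp add: atLeastLessThanSuc_atLeastAtMost cong: conj_cong)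
qed

lemma run_free_snoc_failure:
  assumes "k \<ge> 1"
  shows "run_free k (w @ [False]) \<longleftrightarrow> run_free k w"
proof -
  have "\<exists>i\<in>{Suc (length w) - k..length w}. \<not> (w @ [False]) ! i"
    by (rule bexI[of _ "length w"]) (use assms in auto)
  then show ?thesis by (simp add: run_free_snoc)
qed

text \<open>
  A run that reaches into \<open>w\<close> would have to pass over the failure at the end of \<open>w\<close>.
\<close>

lemma run_free_append_successes:
  assumes "k \<ge> 1" and "w = [] \<or> \<not> last w"
  shows "run_free k (w @ replicate x True) \<longleftrightarrow> run_free k w \<and> x < k"
proof (induction x)
  case 0
  then show ?case using assms(1) by simp
next
  case (Suc x)
  let ?w = "w @ replicate x True"
  let ?n = "Suc (length ?w)"
  have rep: "w @ replicate (Suc x) True = ?w @ [True]"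
    by (simp add: replicate_append_same)
  have "(k \<le> ?n \<longrightarrow> (\<exists>i\<in>{?n - k..length ?w}. \<not> (?w @ [True]) ! i)) \<longleftrightarrow> Suc x < k" if "x < k"
  proof (cases "Suc x < k")
    case True
    have "\<exists>i\<in>{?n - k..length ?w}. \<not> (?w @ [True]) ! i" if "k \<le> ?n"
    proof -
      have "w \<noteq> []" using that True by auto
      then show ?thesis using assms(2) True that
        by (intro bexI[of _ "length w - 1"]) (auto simp: nth_append last_conv_nth)
    qed
    then show ?thesis using True by simp
  next
    case False
    then have "k = Suc x" using that by simp
    then show ?thesis by (auto simp: nth_append nth_Cons split: if_splits nat.splits)
  qed
  then show ?case
    unfolding rep run_free_snoc[of k ?w] Suc.IH by auto
qed

lemma trailing_successes_exist:
  "\<exists>w' x. w = w' @ replicate x True \<and> (w' = [] \<or> \<not> last w')"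
proof (induction w rule: rev_induct)
  case Nil
  show ?case by (intro exI[of _ "[]"] exI[of _ 0]) simp
next
  case (snoc b w)
  show ?case
  proof (cases b)
    case True
    obtain w' x where "w = w' @ replicate x True" "w' = [] \<or> \<not> last w'"
      using snoc.IH by blast
    then show ?thesis using True
      by (intro exI[of _ w'] exI[of _ "Suc x"]) (simp add: replicate_append_same)
  next
    case False
    then show ?thesis by (intro exI[of _ "w @ [b]"] exI[of _ 0]) simp
  qed
qed

lemma trailing_successes_unique:
  assumes "w @ replicate x True = w' @ replicate x' True"
    and "w = [] \<or> \<not> last w" and "w' = [] \<or> \<not> last w'"
  shows "x = x' \<and> w = w'"
  using assms(1)
proof (induction x arbitrary: x')
  case 0
  then show ?case using assms(2,3) by (cases x') (auto simp: replicate_append_same[symmetric])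
next
  case (Suc x)
  then show ?case
    using assms(2,3) by (cases x') (auto simp: replicate_append_same[symmetric] simp flip: append_assoc)
qed

definition word_prob :: "real \<Rightarrow> real \<Rightarrow> bool list \<Rightarrow> real" where
  "word_prob q \<theta> w = (\<Prod>j<length w. let p = \<theta> * q ^ count_list (take j w) False
                                 in if w ! j then p else 1 - p)"

lemma word_prob_Nil [simp]: "word_prob q \<theta> [] = 1"
  by (simp add: word_prob_def)

lemma word_prob_snoc:
  "word_prob q \<theta> (w @ [b]) = word_prob q \<theta> w *
     (let p = \<theta> * q ^ count_list w False in if b then p else 1 - p)"
proof -
  have "(\<Prod>j<length w. let p = \<theta> * q ^ count_list (take j (w @ [b])) False in if (w @ [b]) ! j then p else 1 - p)
      = word_prob q \<theta> w"
    unfolding word_prob_def by (intro prod.cong) (auto simp: nth_append)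
  then show ?thesis by (simp add: word_prob_def[of q \<theta> "w @ [b]"])
qed

lemma count_list_successes [simp]: "count_list (replicate x True) False = 0"
  "count_list (replicate x True) True = x"
  by (induction x) auto

lemma word_prob_append_successes:
  "word_prob q \<theta> (w @ replicate x True) = word_prob q \<theta> w * (\<theta> * q ^ count_list w False) ^ x"
proof (induction x)
  case (Suc x)
  have "w @ replicate (Suc x) True = (w @ replicate x True) @ [True]"
    by (simp add: replicate_append_same)
  then show ?case by (simp only: word_prob_snoc Suc) (simp add: Let_def mult_ac)
qed simp

lemma length_eq_counts: "length w = count_list w True + count_list w False"
  by (induction w) auto

text \<open>
  Words that are sequences of \<open>v\<close> blocks, each of them fewer than \<open>k\<close> successes followed by a failure.
\<close>

definition blocks :: "nat \<Rightarrow> int \<Rightarrow> nat \<Rightarrow> bool list set" where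
  "blocks k u v = {w. int (count_list w True) = u \<and> count_list w False = v \<and> run_free k w \<and>
                      (w = [] \<or> \<not> last w)}"

lemma finite_blocks: "finite (blocks k u v)"
proof (rule finite_subset)
  show "blocks k u v \<subseteq> {w. set w \<subseteq> UNIV \<and> length w = nat u + v}"
    by (auto simp: blocks_def length_eq_counts)
qed (rule finite_lists_length_eq, simp)

lemma run_free_Nil: "k \<ge> 1 \<Longrightarrow> run_free k []"
  by (simp add: run_free_def)

lemma blocks_no_failure:
  assumes "k \<ge> 1"
  shows "blocks k u 0 = (if u = 0 then {[]} else {})"
proof -
  have "w \<in> blocks k u 0 \<longleftrightarrow> u = 0 \<and> w = []" for w
  proof (cases w rule: rev_cases)
    case (snoc w' b)
    then show ?thesis by (cases b) (auto simp: blocks_def)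
  qed (use run_free_Nil[OF assms] in \<open>auto simp: blocks_def\<close>)
  then show ?thesis by auto
qed

lemma blocks_Suc:
  assumes "k \<ge> 1"
  shows "blocks k u (Suc v) =
           (\<lambda>(x, w). w @ replicate x True @ [False]) ` (SIGMA x : {..<k}. blocks k (u - int x) v)"
    (is "_ = ?g ` ?S")
proof (intro equalityI subsetI)
  fix w assume "w \<in> blocks k u (Suc v)"
  then have w: "int (count_list w True) = u" "count_list w False = Suc v" "run_free k w"
    "w = [] \<or> \<not> last w" by (auto simp: blocks_def)
  then have "w \<noteq> []" by auto
  with w(4) obtain w0 where w0: "w = w0 @ [False]"
    by (cases w rule: rev_cases) auto
  obtain w' x where w': "w0 = w' @ replicate x True" "w' = [] \<or> \<not> last w'"
    using trailing_successes_exist by blast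
  have "run_free k w0" using w(3) w0 assms by (simp add: run_free_snoc_failure)
  then have "run_free k w'" "x < k"
    using run_free_append_successes[OF assms w'(2)] w'(1) by auto
  then have "(x, w') \<in> ?S" using w w0 w' by (auto simp: blocks_def)
  moreover have "w = ?g (x, w')" using w0 w' by simp
  ultimately show "w \<in> ?g ` ?S" by blast
next
  fix w assume "w \<in> ?g ` ?S"
  then obtain x w' where *: "w = (w' @ replicate x True) @ [False]" "x < k" "w' \<in> blocks k (u - int x) v"
    by auto
  then show "w \<in> blocks k u (Suc v)"
    using run_free_snoc_failure[OF assms, of "w' @ replicate x True"] run_free_append_successes[OF assms, of w' x]
    by (auto simp: blocks_def)
qed

text \<open>
  The last of \<open>v + 1\<close> blocks, with \<open>x\<close> successes, contributes \<open>(\<theta> q\<^sup>v)\<^sup>x (1 - \<theta> q\<^sup>v)\<close>: all of its trials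
  take place after exactly \<open>v\<close> failures. The powers of \<open>q\<close> make up the recursion of \<open>gap_sum\<close>.
\<close>

lemma sum_word_prob_blocks:
  assumes "k \<ge> 1"
  shows "(\<Sum>w\<in>blocks k u v. word_prob q \<theta> w) =
           \<theta> ^ nat u * (\<Prod>j = 1..v. (1 - \<theta> * q ^ (j - 1))) * gap_sum q k u v"
proof (induction v arbitrary: u)
  case 0
  show ?case by (simp add: blocks_no_failure[OF assms])
next
  case (Suc v)
  let ?S = "SIGMA x : {..<k}. blocks k (u - int x) v"
  let ?P = "\<lambda>v. \<Prod>j = 1..v. (1 - \<theta> * q ^ (j - 1))"
  \<comment> \<open>The block boundary is visible in the word: it follows the last failure before the final one.\<close>
  have inj: "inj_on (\<lambda>(x, w). w @ replicate x True @ [False]) ?S"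
    by (rule inj_onI) (auto simp: blocks_def simp flip: append_assoc dest: trailing_successes_unique)
  have "(\<Sum>w\<in>blocks k u (Suc v). word_prob q \<theta> w)
      = (\<Sum>(x, w)\<in>?S. word_prob q \<theta> ((w @ replicate x True) @ [False]))"
    unfolding blocks_Suc[OF assms] by (subst sum.reindex[OF inj]) (simp add: split_def)
  also have "\<dots> = (\<Sum>(x, w)\<in>?S. word_prob q \<theta> w * ((\<theta> * q ^ v) ^ x * (1 - \<theta> * q ^ v)))"
  proof (intro sum.cong refl, clarify)
    fix x w assume "w \<in> blocks k (u - int x) v"
    then have "count_list w False = v" by (simp add: blocks_def)
    then show "word_prob q \<theta> ((w @ replicate x True) @ [False])
        = word_prob q \<theta> w * ((\<theta> * q ^ v) ^ x * (1 - \<theta> * q ^ v))"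
      by (simp only: word_prob_snoc word_prob_append_successes Let_def)
        (simp add: count_list_append)
  qed
  also have "\<dots> = (\<Sum>x<k. (\<Sum>w\<in>blocks k (u - int x) v. word_prob q \<theta> w) * ((\<theta> * q ^ v) ^ x * (1 - \<theta> * q ^ v)))"
    by (simp add: sum.Sigma[symmetric] finite_blocks sum_distrib_right)
  also have "\<dots> = (\<Sum>x<k. \<theta> ^ nat u * ?P (Suc v) * (q ^ (v * x) * gap_sum q k (u - int x) v))"
  proof (intro sum.cong refl)
    fix x
    \<comment> \<open>For \<open>x > u\<close> the exponents do not add up, but then the polynomial vanishes.\<close>
    have pow: "\<theta> ^ nat (u - int x) * \<theta> ^ x * gap_sum q k (u - int x) v = \<theta> ^ nat u * gap_sum q k (u - int x) v"
    proof (cases "int x \<le> u")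
      case True
      then have "nat u = nat (u - int x) + x" by simp
      then show ?thesis by (simp add: power_add)
    qed (simp add: gap_sum_negative)
    have "(\<Sum>w\<in>blocks k (u - int x) v. word_prob q \<theta> w) * ((\<theta> * q ^ v) ^ x * (1 - \<theta> * q ^ v))
        = ?P (Suc v) * q ^ (v * x) * (\<theta> ^ nat (u - int x) * \<theta> ^ x * gap_sum q k (u - int x) v)"
      unfolding Suc.IH by (simp add: power_mult_distrib power_mult)
    then show "(\<Sum>w\<in>blocks k (u - int x) v. word_prob q \<theta> w) * ((\<theta> * q ^ v) ^ x * (1 - \<theta> * q ^ v))
        = \<theta> ^ nat u * ?P (Suc v) * (q ^ (v * x) * gap_sum q k (u - int x) v)"
      unfolding pow by (simp only: mult_ac)
  qed
  also have "\<dots> = \<theta> ^ nat u * ?P (Suc v) * gap_sum q k u (Suc v)"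
    by (simp add: sum_distrib_left)
  finally show ?case .
qed

section \<open>Waiting times read off from words\<close>

lemma less_INF_enat_iff: "(INF n \<in> S. enat n) > enat m \<longleftrightarrow> (\<forall>n\<in>S. n > m)"
  by (simp add: le_INF_iff flip: Suc_ile_eq) (simp add: Suc_le_eq)

text \<open>
  This reduces the law of a waiting time to its tail events, which are easier to read off from a word.
\<close>

lemma enat_eq_Suc_iff: "t = enat (Suc m) \<longleftrightarrow> enat m < t \<and> \<not> enat (Suc m) < t"
  by (cases t) auto

definition success_word :: "nat \<Rightarrow> (nat \<Rightarrow> nat) \<Rightarrow> bool list" where
  "success_word n x = map (\<lambda>j. x j = 1) [1..<Suc n]"

lemma success_word_0: "success_word 0 x = []"
  by (simp add: success_word_def)

lemma success_word_Suc: "success_word (Suc n) x = success_word n x @ [x (Suc n) = 1]"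
  by (simp add: success_word_def)

lemma length_success_word: "length (success_word n x) = n"
  by (simp add: success_word_def)

lemma nth_success_word: "i < n \<Longrightarrow> success_word n x ! i \<longleftrightarrow> x (Suc i) = 1"
  by (simp add: success_word_def nth_append del: upt_Suc)

lemma run_time_greater_iff:
  "success_run_time k x > enat n \<longleftrightarrow> run_free k (success_word n x)"
proof -
  have window: "(\<exists>i\<in>{m - k..<m}. \<not> success_word n x ! i) \<longleftrightarrow> \<not> (\<forall>j\<in>{m - k + 1..m}. x j = 1)"
    if "m \<le> n" for m
  proof -
    have shift: "{m - k + 1..m} = Suc ` {m - k..<m}"
      by (simp add: image_Suc_atLeastLessThan atLeastLessThanSuc_atLeastAtMost)
    have "(\<forall>j\<in>{m - k + 1..m}. x j = 1) \<longleftrightarrow> (\<forall>i\<in>{m - k..<m}. x (Suc i) = 1)"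
      unfolding shift by blast
    then show ?thesis using that by (auto simp: nth_success_word)
  qed
  show ?thesis
    unfolding success_run_time_def less_INF_enat_iff run_free_def length_success_word
    using window by (auto simp: not_less[symmetric] simp del: not_less)
qed

definition failures :: "nat \<Rightarrow> (nat \<Rightarrow> nat) \<Rightarrow> nat" where
  "failures n x = card {j \<in> {1..n}. x j = 0}"

lemma failures_Suc: "failures (Suc n) x = failures n x + (if x (Suc n) = 0 then 1 else 0)"
proof -
  have "{j \<in> {1..Suc n}. x j = 0} =
      (if x (Suc n) = 0 then insert (Suc n) {j \<in> {1..n}. x j = 0} else {j \<in> {1..n}. x j = 0})"
    by (auto simp: le_Suc_eq)
  then show ?thesis by (simp add: failures_def)
qed

lemma failures_0: "failures 0 x = 0"
  by (simp add: failures_def)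

lemma failures_mono: "m \<le> n \<Longrightarrow> failures m x \<le> failures n x"
  by (auto simp: failures_def intro!: card_mono)

lemma failures_eq_count_list:
  assumes "\<forall>j\<ge>1. x j \<in> {0, 1}"
  shows "failures n x = count_list (success_word n x) False"
proof (induction n)
  case (Suc n)
  then show ?case using assms[rule_format, of "Suc n"] by (auto simp: failures_Suc success_word_Suc)
qed (simp add: failures_0 success_word_0)

text \<open>
  The number of failures grows in steps of at most one, so it attains \<open>k\<close>, and first does so at a failure.
\<close>

lemma kth_failure_exists:
  assumes "k \<ge> 1" and "k \<le> failures n x"
  shows "\<exists>m. 1 \<le> m \<and> m \<le> n \<and> x m = 0 \<and> failures m x = k"
  using assms(2)
proof (induction n)
  case (Suc n)
  show ?case
  proof (cases "k \<le> failures n x")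
    case True
    then show ?thesis using Suc.IH by (meson le_SucI)
  next
    case False
    then show ?thesis using Suc.prems
      by (intro exI[of _ "Suc n"]) (auto simp: failures_Suc split: if_splits)
  qed
qed (use assms(1) in \<open>simp add: failures_0\<close>)

lemma failure_time_greater_iff:
  assumes "k \<ge> 1"
  shows "failure_time k x > enat n \<longleftrightarrow> failures n x < k"
proof -
  have "failure_time k x > enat n \<longleftrightarrow> (\<forall>m. 1 \<le> m \<and> x m = 0 \<and> failures m x = k \<longrightarrow> n < m)"
    by (simp add: failure_time_def less_INF_enat_iff failures_def)
  also have "\<dots> \<longleftrightarrow> failures n x < k"
    using kth_failure_exists[OF assms, of n x] failures_mono[of _ n x] by (meson leD leI)
  finally show ?thesis .
qed

text \<open>
  The run is completed at trial \<open>n\<close> iff the first \<open>n\<close> trials contain a run of length \<open>k\<close> and the first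
  \<open>n - 1\<close> do not. Writing the word as \<open>w\<close> followed by its trailing \<open>l\<close> successes, this says that \<open>w\<close>
  contains no such run and that \<open>l = k\<close>.
\<close>

lemma run_time_eq_iff:
  assumes "k \<ge> 1" and "n \<ge> 1"
  shows "success_run_time k x = enat n \<longleftrightarrow>
    (\<exists>w. success_word n x = w @ replicate k True \<and> run_free k w \<and> (w = [] \<or> \<not> last w))"
    (is "_ \<longleftrightarrow> ?R")
proof -
  obtain m where m: "n = Suc m" using assms(2) by (cases n) auto
  obtain w l where w: "success_word n x = w @ replicate l True" "w = [] \<or> \<not> last w"
    using trailing_successes_exist by blast
  have R: "?R \<longleftrightarrow> l = k \<and> run_free k w"
    using w trailing_successes_unique[OF _ w(2)] by metis
  have "success_run_time k x = enat n \<longleftrightarrow>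
      run_free k (success_word m x) \<and> \<not> run_free k (success_word n x)"
    unfolding m enat_eq_Suc_iff run_time_greater_iff ..
  also have "run_free k (success_word n x) \<longleftrightarrow> run_free k w \<and> l < k"
    unfolding w(1) by (rule run_free_append_successes[OF assms(1) w(2)])
  also have "run_free k (success_word m x) \<and> \<not> (run_free k w \<and> l < k) \<longleftrightarrow> l = k \<and> run_free k w"
  proof (cases l)
    case 0
    then have w': "success_word m x @ [x n = 1] = w" using w(1) by (simp add: m success_word_Suc)
    then have "\<not> x n = 1" using w(2) by auto
    then have "run_free k w \<longleftrightarrow> run_free k (success_word m x)"
      using w' run_free_snoc_failure[OF assms(1), of "success_word m x"] by auto
    then show ?thesis using 0 assms(1) by auto
  next
    case (Suc l')
    then have "success_word m x = w @ replicate l' True"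
      using w(1) by (simp add: m success_word_Suc replicate_append_same[symmetric] flip: append_assoc)
    then show ?thesis
      using run_free_append_successes[OF assms(1) w(2), of l'] Suc by auto
  qed
  finally show ?thesis using R by blast
qed

lemma failure_time_eq_iff:
  assumes "\<forall>j\<ge>1. x j \<in> {0, 1}" and "k \<ge> 1" and "n \<ge> 1"
  shows "failure_time k x = enat n \<longleftrightarrow>
    count_list (success_word n x) False = k \<and> \<not> last (success_word n x)"
proof -
  obtain m where m: "n = Suc m" using assms(3) by (cases n) auto
  have "failure_time k x = enat n \<longleftrightarrow> failures m x < k \<and> \<not> failures n x < k"
    unfolding m enat_eq_Suc_iff failure_time_greater_iff[OF assms(2)] ..
  also have "\<dots> \<longleftrightarrow> failures n x = k \<and> x n = 0"
    by (auto simp: m failures_Suc split: if_splits)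
  also have "x n = 0 \<longleftrightarrow> \<not> last (success_word n x)"
    using assms(1)[rule_format, of n] by (auto simp: m success_word_Suc)
  finally show ?thesis using failures_eq_count_list[OF assms(1), of n] by simp
qed

section \<open>Laws of words and waiting times\<close>

context q_bernoulli_trials
begin

lemma outcome_binary: "\<omega> \<in> space M \<Longrightarrow> j \<ge> 1 \<Longrightarrow> X j \<omega> \<in> {0, 1}"
  using measurable_space[OF binary] by auto

lemma success_word_event:
  "{\<omega> \<in> space M. success_word n (\<lambda>j. X j \<omega>) = w} \<in> events"
proof (induction n arbitrary: w)
  case 0
  show ?case by (cases "w = []") (auto simp: success_word_0)
next
  case (Suc n)
  have "X (Suc n) -` {1} \<inter> space M \<in> events" "X (Suc n) -` {0} \<inter> space M \<in> events"
    by (rule measurable_sets[OF binary], simp_all)+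
  then have *: "{\<omega> \<in> space M. (X (Suc n) \<omega> = 1) = b} \<in> events" for b
  proof (cases b)
    case False
    have "{\<omega> \<in> space M. (X (Suc n) \<omega> = 1) = b} = X (Suc n) -` {0} \<inter> space M"
      using outcome_binary[of _ "Suc n"] False by auto
    then show ?thesis using \<open>X (Suc n) -` {0} \<inter> space M \<in> events\<close> by simp
  qed (simp add: vimage_def Int_def conj_commute)
  show ?case
  proof (cases w rule: rev_cases)
    case (snoc w' b)
    have "{\<omega> \<in> space M. success_word (Suc n) (\<lambda>j. X j \<omega>) = w} =
        {\<omega> \<in> space M. success_word n (\<lambda>j. X j \<omega>) = w'} \<inter> {\<omega> \<in> space M. (X (Suc n) \<omega> = 1) = b}"
      by (auto simp: snoc success_word_Suc)
    then show ?thesis using Suc.IH[of w'] *[of b] by simp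
  qed (simp add: success_word_Suc)
qed

text \<open>
  By the product rule for conditional probabilities, one trial at a time. The conditional laws are only
  known for histories of positive probability; an extension of a null history is a null event, in
  accordance with the product formula, which then has a zero factor already.
\<close>

lemma prob_success_word:
  "length w = n \<Longrightarrow> prob {\<omega> \<in> space M. success_word n (\<lambda>j. X j \<omega>) = w} = word_prob q \<theta> w"
proof (induction n arbitrary: w)
  case 0
  then show ?case by (simp add: success_word_0 prob_space)
next
  case (Suc n)
  then obtain w' b where w: "w = w' @ [b]" "length w' = n"
    by (cases w rule: rev_cases) auto
  \<comment> \<open>The history in the form in which the conditional laws refer to it: 0/1 values indexed from 1.\<close>
  define e where "e l = (if w' ! (l - 1) then 1 else 0 :: nat)" for l
  define H where "H = {\<omega> \<in> space M. success_word n (\<lambda>j. X j \<omega>) = w'}"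
  let ?z = "count_list w' False"
  have hist: "(\<forall>l\<in>{1..<Suc n}. X l \<omega> = e l) \<longleftrightarrow> success_word n (\<lambda>j. X j \<omega>) = w'"
    if "\<omega> \<in> space M" for \<omega>
  proof -
    have "success_word n (\<lambda>j. X j \<omega>) = w' \<longleftrightarrow> (\<forall>i<n. (X (Suc i) \<omega> = 1) = w' ! i)"
      using w(2) by (auto simp: list_eq_iff_nth_eq length_success_word nth_success_word)
    also have "\<dots> \<longleftrightarrow> (\<forall>i<n. X (Suc i) \<omega> = e (Suc i))"
    proof -
      have "(X (Suc i) \<omega> = 1) = w' ! i \<longleftrightarrow> X (Suc i) \<omega> = e (Suc i)" for i
        using outcome_binary[OF that, of "Suc i"] by (auto simp: e_def)
      then show ?thesis by simp
    qed
    also have "\<dots> \<longleftrightarrow> (\<forall>l\<in>{1..<Suc n}. X l \<omega> = e l)"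
    proof -
      have shift: "{1..<Suc n} = Suc ` {..<n}"
        by (simp add: image_Suc_lessThan atLeastLessThanSuc_atLeastAtMost)
      show ?thesis unfolding shift by blast
    qed
    finally show ?thesis by simp
  qed
  have "{l \<in> {1..<Suc n}. e l = 0} = Suc ` {i. i < n \<and> \<not> w' ! i}"
  proof (intro set_eqI)
    fix l
    show "l \<in> {l \<in> {1..<Suc n}. e l = 0} \<longleftrightarrow> l \<in> Suc ` {i. i < n \<and> \<not> w' ! i}"
      by (cases l) (auto simp: e_def)
  qed
  then have "card {l \<in> {1..<Suc n}. e l = 0} = card {i. i < length w' \<and> w' ! i = False}"
    using w(2) by (simp add: card_image)
  also have "\<dots> = ?z"
    by (simp add: count_list_eq_length_filter length_filter_conv_card)
  finally have z: "card {l \<in> {1..<Suc n}. e l = 0} = Suc ?z - 1" by simp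
  have H: "\<P>(\<omega> in M. \<forall>l\<in>{1..<Suc n}. X l \<omega> = e l) = word_prob q \<theta> w'"
    using Suc.IH[OF w(2)] hist by (simp cong: conj_cong)
  let ?c = "if b then 1 else 0 :: nat"
  let ?p = "let p = \<theta> * q ^ ?z in if b then p else 1 - p"
  have "prob {\<omega> \<in> space M. success_word (Suc n) (\<lambda>j. X j \<omega>) = w}
      = \<P>(\<omega> in M. X (Suc n) \<omega> = ?c \<and> (\<forall>l\<in>{1..<Suc n}. X l \<omega> = e l))"
  proof (rule arg_cong[where f = prob], rule Collect_cong, rule conj_cong[OF refl])
    fix \<omega> assume "\<omega> \<in> space M"
    then show "(success_word (Suc n) (\<lambda>j. X j \<omega>) = w) =
        (X (Suc n) \<omega> = ?c \<and> (\<forall>l\<in>{1..<Suc n}. X l \<omega> = e l))"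
      unfolding hist[OF \<open>\<omega> \<in> space M\<close>] w(1) success_word_Suc
      using outcome_binary[of \<omega> "Suc n"] by auto
  qed
  also have "\<dots> = word_prob q \<theta> w' * ?p"
  proof (cases "word_prob q \<theta> w' = 0")
    case True
    have "\<P>(\<omega> in M. X (Suc n) \<omega> = ?c \<and> (\<forall>l\<in>{1..<Suc n}. X l \<omega> = e l))
        \<le> \<P>(\<omega> in M. \<forall>l\<in>{1..<Suc n}. X l \<omega> = e l)"
      using success_word_event[of n w'] hist
      by (intro finite_measure_mono) (auto cong: conj_cong)
    then show ?thesis using True H by (simp add: antisym)
  next
    case False
    then have pos: "\<P>(\<omega> in M. \<forall>l\<in>{1..<Suc n}. X l \<omega> = e l) > 0"
      unfolding H[symmetric] by (simp add: zero_less_measure_iff)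
    have "\<P>(\<omega> in M. X (Suc n) \<omega> = ?c \<bar> \<forall>l\<in>{1..<Suc n}. X l \<omega> = e l) = ?p"
      using failure_prob[OF _ _ z pos] success_prob[OF _ _ z pos] by (auto simp: Let_def)
    then show ?thesis using False unfolding cond_prob_def H by (simp add: field_simps)
  qed
  finally show ?case by (simp add: w(1) word_prob_snoc)
qed

lemma prob_success_word_in:
  assumes "\<And>w. w \<in> A \<Longrightarrow> length w = n"
  shows "{\<omega> \<in> space M. success_word n (\<lambda>j. X j \<omega>) \<in> A} \<in> events"
    and "prob {\<omega> \<in> space M. success_word n (\<lambda>j. X j \<omega>) \<in> A} = (\<Sum>w\<in>A. word_prob q \<theta> w)"
proof -
  let ?E = "\<lambda>w. {\<omega> \<in> space M. success_word n (\<lambda>j. X j \<omega>) = w}"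
  have fin: "finite A"
    by (rule finite_subset[OF _ finite_lists_length_eq[of UNIV n]]) (use assms in auto)
  have *: "{\<omega> \<in> space M. success_word n (\<lambda>j. X j \<omega>) \<in> A} = (\<Union>w\<in>A. ?E w)"
    by auto
  show "{\<omega> \<in> space M. success_word n (\<lambda>j. X j \<omega>) \<in> A} \<in> events"
    unfolding * using fin success_word_event by (intro sets.finite_UN)
  have "prob (\<Union>w\<in>A. ?E w) = (\<Sum>w\<in>A. prob (?E w))"
    using fin success_word_event by (intro finite_measure_finite_Union) (auto simp: disjoint_family_on_def)
  then show "prob {\<omega> \<in> space M. success_word n (\<lambda>j. X j \<omega>) \<in> A} = (\<Sum>w\<in>A. word_prob q \<theta> w)"
    unfolding * using assms by (simp add: prob_success_word)
qed

end

text \<open>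
  Words of length \<open>n\<close> that complete their first run of \<open>k1\<close> successes at the last letter. The \<open>k1\<close>
  final successes and the \<open>i\<close> failures are subtracted from \<open>n\<close> to get the number of the other successes.
\<close>

definition run_first_words :: "nat \<Rightarrow> nat \<Rightarrow> nat \<Rightarrow> bool list set" where
  "run_first_words k1 k2 n = (\<lambda>w. w @ replicate k1 True) ` (\<Union>i<k2. blocks k1 (int n - int k1 - int i) i)"

context q_bernoulli_trials
begin

lemma run_first_event:
  assumes "k1 \<ge> 1" and "k2 \<ge> 1" and "n \<ge> 1" and "\<omega> \<in> space M"
  shows "success_run_time k1 (\<lambda>j. X j \<omega>) = enat n \<and> failure_time k2 (\<lambda>j. X j \<omega>) > enat n \<longleftrightarrow>
    success_word n (\<lambda>j. X j \<omega>) \<in> run_first_words k1 k2 n"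
proof -
  let ?x = "\<lambda>j. X j \<omega>" and ?w = "success_word n (\<lambda>j. X j \<omega>)"
  have bin: "\<forall>j\<ge>1. ?x j \<in> {0, 1}" using outcome_binary[OF assms(4)] by blast
  have len: "n = length w + k1" if "?w = w @ replicate k1 True" for w
    using length_success_word[of n ?x] that by simp
  have "success_run_time k1 ?x = enat n \<and> failure_time k2 ?x > enat n \<longleftrightarrow>
      (\<exists>w. ?w = w @ replicate k1 True \<and> run_free k1 w \<and> (w = [] \<or> \<not> last w)) \<and> count_list ?w False < k2"
    unfolding run_time_eq_iff[OF assms(1,3)] failure_time_greater_iff[OF assms(2)]
      failures_eq_count_list[of ?x, OF bin] ..
  also have "\<dots> \<longleftrightarrow> ?w \<in> run_first_words k1 k2 n"
    using len by (fastforce simp: run_first_words_def blocks_def length_eq_counts)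
  finally show ?thesis .
qed

lemma failures_first_event:
  assumes "k1 \<ge> 1" and "k2 \<ge> 1" and "n \<ge> 1" and "\<omega> \<in> space M"
  shows "failure_time k2 (\<lambda>j. X j \<omega>) = enat n \<and> success_run_time k1 (\<lambda>j. X j \<omega>) > enat n \<longleftrightarrow>
    success_word n (\<lambda>j. X j \<omega>) \<in> blocks k1 (int n - int k2) k2"
proof -
  let ?x = "\<lambda>j. X j \<omega>" and ?w = "success_word n (\<lambda>j. X j \<omega>)"
  have bin: "\<forall>j\<ge>1. ?x j \<in> {0, 1}" using outcome_binary[OF assms(4)] by blast
  have "n = count_list ?w True + count_list ?w False" "?w \<noteq> []"
    using length_success_word[of n ?x] assms(3) by (auto simp: length_eq_counts[symmetric])
  then show ?thesis
    unfolding failure_time_eq_iff[of ?x, OF bin assms(2,3)] run_time_greater_iff blocks_def by auto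
qed

lemma length_run_first_words: "w \<in> run_first_words k1 k2 n \<Longrightarrow> length w = n"
  by (auto simp: run_first_words_def blocks_def length_eq_counts)

lemma length_blocks: "w \<in> blocks k (int n - int v) v \<Longrightarrow> length w = n"
  by (auto simp: blocks_def length_eq_counts)

lemma P1_S_eq_prob_words:
  assumes "k1 \<ge> 1" and "k2 \<ge> 1" and "n \<ge> 1"
  shows "P1_S M X k1 k2 n = prob {\<omega> \<in> space M. success_word n (\<lambda>j. X j \<omega>) \<in> run_first_words k1 k2 n}"
  unfolding P1_S_def using run_first_event[OF assms] by (simp cong: conj_cong)

lemma P0_S_eq_prob_words:
  assumes "k1 \<ge> 1" and "k2 \<ge> 1" and "n \<ge> 1"
  shows "P0_S M X k1 k2 n =
    prob {\<omega> \<in> space M. success_word n (\<lambda>j. X j \<omega>) \<in> blocks k1 (int n - int k2) k2}"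
  unfolding P0_S_def using failures_first_event[OF assms] by (simp cong: conj_cong)

lemma prob_W_S:
  assumes "k1 \<ge> 1" and "k2 \<ge> 1" and "n \<ge> 1"
  shows "\<P>(\<omega> in M. W_S k1 k2 (\<lambda>j. X j \<omega>) = enat n) = P1_S M X k1 k2 n + P0_S M X k1 k2 n"
proof -
  let ?w = "\<lambda>\<omega>. success_word n (\<lambda>j. X j \<omega>)"
  let ?A = "run_first_words k1 k2 n" and ?B = "blocks k1 (int n - int k2) k2"
  \<comment> \<open>The last trial would have to be a success and a failure at once.\<close>
  have disj: "\<not> (success_run_time k1 x = enat n \<and> failure_time k2 x = enat n)"
    if "\<forall>j\<ge>1. x j \<in> {0, 1}" for x
    using run_time_eq_iff[OF assms(1,3), of x] failure_time_eq_iff[OF that assms(2,3)] assms(1)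
    by (auto simp: last_append)
  have "W_S k1 k2 (\<lambda>j. X j \<omega>) = enat n \<longleftrightarrow> ?w \<omega> \<in> ?A \<or> ?w \<omega> \<in> ?B" if "\<omega> \<in> space M" for \<omega>
    unfolding run_first_event[OF assms that, symmetric] failures_first_event[OF assms that, symmetric]
    using disj[of "\<lambda>j. X j \<omega>"] outcome_binary[OF that] unfolding W_S_def min_def
    by (auto simp: not_le)
  then have "{\<omega> \<in> space M. W_S k1 k2 (\<lambda>j. X j \<omega>) = enat n} =
      {\<omega> \<in> space M. ?w \<omega> \<in> ?A} \<union> {\<omega> \<in> space M. ?w \<omega> \<in> ?B}"
    by auto
  moreover have "?A \<inter> ?B = {}"
    using assms(1) by (auto simp: run_first_words_def blocks_def last_append)
  then have "{\<omega> \<in> space M. ?w \<omega> \<in> ?A} \<inter> {\<omega> \<in> space M. ?w \<omega> \<in> ?B} = {}"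
    by auto
  ultimately show ?thesis
    unfolding P1_S_eq_prob_words[OF assms] P0_S_eq_prob_words[OF assms]
    by (simp add: finite_measure_Union prob_success_word_in(1) length_run_first_words length_blocks)
qed

lemma P0_S_eq:
  assumes "k1 \<ge> 1" and "k2 \<ge> 1" and "n \<ge> k2"
  shows "P0_S M X k1 k2 n =
    \<theta> ^ (n - k2) * (\<Prod>j = 1..k2. (1 - \<theta> * q ^ (j - 1))) * gap_sum q k1 (int n - int k2) k2"
proof -
  have "nat (int n - int k2) = n - k2" by simp
  then show ?thesis
    using assms P0_S_eq_prob_words[of k1 k2 n]
      prob_success_word_in(2)[of "blocks k1 (int n - int k2) k2" n, OF length_blocks]
    by (simp add: sum_word_prob_blocks)
qed

text \<open>
  The exponent of \<open>\<theta>\<close> is the number of successes of a word with \<open>i\<close> failures, including the final run.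
\<close>

lemma P1_S_eq:
  assumes "k1 \<ge> 1" and "k2 \<ge> 1" and "n \<ge> k1"
  shows "P1_S M X k1 k2 n =
    (\<Sum>i<k2. \<theta> ^ nat (int n - int i) * q ^ (i * k1) * (\<Prod>j = 1..i. (1 - \<theta> * q ^ (j - 1)))
            * gap_sum q k1 (int n - int k1 - int i) i)"
proof -
  let ?B = "\<lambda>i. blocks k1 (int n - int k1 - int i) i"
  have "P1_S M X k1 k2 n = (\<Sum>w\<in>run_first_words k1 k2 n. word_prob q \<theta> w)"
    using assms P1_S_eq_prob_words[of k1 k2 n]
      prob_success_word_in(2)[of "run_first_words k1 k2 n" n, OF length_run_first_words] by simp
  also have "\<dots> = (\<Sum>w\<in>(\<Union>i<k2. ?B i). word_prob q \<theta> (w @ replicate k1 True))"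
    unfolding run_first_words_def by (subst sum.reindex) (auto simp: inj_on_def)
  also have "\<dots> = (\<Sum>i<k2. \<Sum>w\<in>?B i. word_prob q \<theta> (w @ replicate k1 True))"
    by (rule sum.UNION_disjoint) (simp, simp add: finite_blocks, auto simp: blocks_def)
  also have "\<dots> = (\<Sum>i<k2. (\<Sum>w\<in>?B i. word_prob q \<theta> w) * (\<theta> * q ^ i) ^ k1)"
    by (simp add: word_prob_append_successes sum_distrib_right blocks_def)
  also have "\<dots> = (\<Sum>i<k2. \<theta> ^ nat (int n - int i) * q ^ (i * k1) * (\<Prod>j = 1..i. (1 - \<theta> * q ^ (j - 1)))
            * gap_sum q k1 (int n - int k1 - int i) i)"
  proof (intro sum.cong refl)
    fix i
    let ?g = "gap_sum q k1 (int n - int k1 - int i) i"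
    let ?P = "\<Prod>j = 1..i. (1 - \<theta> * q ^ (j - 1))"
    \<comment> \<open>As above, the exponents only fail to add up when the polynomial vanishes.\<close>
    have pow: "\<theta> ^ nat (int n - int k1 - int i) * \<theta> ^ k1 * ?g = \<theta> ^ nat (int n - int i) * ?g"
    proof (cases "int i + int k1 \<le> int n")
      case True
      then have "nat (int n - int i) = nat (int n - int k1 - int i) + k1" by simp
      then show ?thesis by (simp add: power_add)
    qed (simp add: gap_sum_negative)
    have "(\<Sum>w\<in>?B i. word_prob q \<theta> w) * (\<theta> * q ^ i) ^ k1
        = q ^ (i * k1) * ?P * (\<theta> ^ nat (int n - int k1 - int i) * \<theta> ^ k1 * ?g)"
      unfolding sum_word_prob_blocks[OF assms(1)] by (simp add: power_mult_distrib power_mult)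
    then show "(\<Sum>w\<in>?B i. word_prob q \<theta> w) * (\<theta> * q ^ i) ^ k1 =
        \<theta> ^ nat (int n - int i) * q ^ (i * k1) * ?P * ?g"
      unfolding pow by (simp only: mult_ac)
  qed
  finally show ?thesis .
qed

end

text \<open>
  The only gap vector with sum 0 is the zero vector.
\<close>

lemma gap_sum_no_success:
  assumes "k \<ge> 1"
  shows "gap_sum q k 0 v = 1"
proof (induction v)
  case (Suc v)
  have "gap_sum q k 0 (Suc v) = (\<Sum>x<k. if x = 0 then 1 else 0)"
    unfolding gap_sum.simps by (intro sum.cong) (auto simp: Suc gap_sum_negative)
  then show ?case using assms by simp
qed simp

theorem theorem4p3:
  fixes M :: "'a measure" and X :: "nat \<Rightarrow> 'a \<Rightarrow> nat" and q \<theta> :: real and k1 k2 :: nat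
  assumes "0 \<le> \<theta>" and "\<theta> \<le> 1" and "0 < q" and "q < 1"
    and "q_bernoulli_trials M X q \<theta>"
    and "k1 \<ge> 1" and "k2 \<ge> 1"
  shows "(\<forall>n \<ge> min k1 k2.
            \<P>(\<omega> in M. W_S k1 k2 (\<lambda>j. X j \<omega>) = enat n) = P1_S M X k1 k2 n + P0_S M X k1 k2 n) \<and>
         P1_S M X k1 k2 k1 = \<theta> ^ k1 \<and>
         P0_S M X k1 k2 k2 = (\<Prod>j = 1..k2. (1 - \<theta> * q ^ (j - 1))) \<and>
         (\<forall>n > k1. P1_S M X k1 k2 n =
            (\<Sum>i = 1..min (n - k1) (k2 - 1).
               \<theta> ^ (n - i) * q ^ (i * k1) * (\<Prod>j = 1..i. (1 - \<theta> * q ^ (j - 1))) *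
               (\<Sum>s = 1..i. E_bar q k1 (int n - int k1 - int i) (int i) s
                          + F_bar q k1 (int n - int k1 - int i) (int i) s))) \<and>
         (\<forall>n > k2. P0_S M X k1 k2 n =
            \<theta> ^ (n - k2) * (\<Prod>j = 1..k2. (1 - \<theta> * q ^ (j - 1))) *
            (\<Sum>s = 1..k2. E_bar q k1 (int n - int k2) (int k2) s
                        + F_bar q k1 (int n - int k2) (int k2) s))"
proof (intro conjI allI impI)
  interpret q_bernoulli_trials M X q \<theta> by fact
  let ?P = "\<lambda>i. \<Prod>j = 1..i. (1 - \<theta> * q ^ (j - 1))"
  \<comment> \<open>The sums over \<open>s\<close> in the claim are gap polynomials, so only summation ranges remain to be compared.\<close>
  have runs: "(\<Sum>s = 1..v. E_bar q k1 u (int v) s + F_bar q k1 u (int v) s) = gap_sum q k1 u v"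
    if "v \<ge> 1" for u v
    using sum_runs_sum_eq_gap_sum[OF assms(6) that] by (simp add: runs_sum_def)
  show "\<P>(\<omega> in M. W_S k1 k2 (\<lambda>j. X j \<omega>) = enat n) = P1_S M X k1 k2 n + P0_S M X k1 k2 n"
    if "n \<ge> min k1 k2" for n
    using that assms(6,7) by (intro prob_W_S) auto
  show "P1_S M X k1 k2 k1 = \<theta> ^ k1"
  proof -
    have "P1_S M X k1 k2 k1 = (\<Sum>i<k2. if i = 0 then \<theta> ^ k1 else 0)"
      unfolding P1_S_eq[OF assms(6,7) order_refl]
      by (intro sum.cong) (auto simp: gap_sum_negative)
    then show ?thesis using assms(7) by simp
  qed
  show "P0_S M X k1 k2 k2 = ?P k2"
    unfolding P0_S_eq[OF assms(6,7) order_refl] by (simp add: gap_sum_no_success[OF assms(6)])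
  show "P0_S M X k1 k2 n = \<theta> ^ (n - k2) * ?P k2 *
      (\<Sum>s = 1..k2. E_bar q k1 (int n - int k2) (int k2) s + F_bar q k1 (int n - int k2) (int k2) s)"
    if "n > k2" for n
    unfolding runs[OF assms(7)] using that by (intro P0_S_eq assms(6,7)) simp
  show "P1_S M X k1 k2 n =
      (\<Sum>i = 1..min (n - k1) (k2 - 1). \<theta> ^ (n - i) * q ^ (i * k1) * ?P i *
         (\<Sum>s = 1..i. E_bar q k1 (int n - int k1 - int i) (int i) s
                    + F_bar q k1 (int n - int k1 - int i) (int i) s))"
    if "n > k1" for n
  proof -
    let ?t = "\<lambda>i. \<theta> ^ nat (int n - int i) * q ^ (i * k1) * ?P i * gap_sum q k1 (int n - int k1 - int i) i"
    have "P1_S M X k1 k2 n = (\<Sum>i<k2. ?t i)"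
      using that by (intro P1_S_eq assms(6,7)) simp
    \<comment> \<open>Without failures there is no word, as \<open>n > k1\<close>; with more than \<open>n - k1\<close> failures there is no room for the run.\<close>
    also have "\<dots> = (\<Sum>i = 1..min (n - k1) (k2 - 1). ?t i)"
    proof (rule sum.mono_neutral_right)
      show "\<forall>i\<in>{..<k2} - {1..min (n - k1) (k2 - 1)}. ?t i = 0"
      proof
        fix i assume "i \<in> {..<k2} - {1..min (n - k1) (k2 - 1)}"
        then have "i = 0 \<or> int n - int k1 - int i < 0" by auto
        then have "gap_sum q k1 (int n - int k1 - int i) i = 0"
          using that by (auto simp: gap_sum_negative)
        then show "?t i = 0" by simp
      qed
    qed (use assms(7) in auto)
    also have "\<dots> = (\<Sum>i = 1..min (n - k1) (k2 - 1). \<theta> ^ (n - i) * q ^ (i * k1) * ?P i *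
         (\<Sum>s = 1..i. E_bar q k1 (int n - int k1 - int i) (int i) s
                    + F_bar q k1 (int n - int k1 - int i) (int i) s))"
    proof (intro sum.cong refl)
      fix i assume "i \<in> {1..min (n - k1) (k2 - 1)}"
      then have "i \<ge> 1" and "nat (int n - int i) = n - i" by auto
      then show "?t i = \<theta> ^ (n - i) * q ^ (i * k1) * ?P i *
         (\<Sum>s = 1..i. E_bar q k1 (int n - int k1 - int i) (int i) s
                    + F_bar q k1 (int n - int k1 - int i) (int i) s)"
        by (simp only: runs)
    qed
    finally show ?thesis .
  qed
qed

end
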